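(* Let $C^*=\bigoplus_{q=0}^N C^q$ be a finite-dimensional graded complex vector space with $d:C^q\to C^{q+1}$, $d^2=0$, and $d^*:C^q\to C^{q-1}$, $(d^* )^2=0$. Assume that $\Delta:=dd^*+d^*d$ does not have $0$ as an eigenvalue, and let $\{\lambda_{q,j}\}_{j=1}^{n_q}$ be the eigenvalues of $\Delta_q=\Delta|C^q$ counted with (algebraic) multiplicity. Then $H^q(C^*,d)=0$ and $H_q(C^*,d^* )=0$ for all $q$, and the complex number $torsion(C^*,d,d^* )$ satisfies $$torsion(C^*,d,d^* )=\Big[\prod_{q=0}^N(\det\Delta_q)^{(-1)^q q}\Big]^{-1}=\Big[\prod_{q=0}^N\Big(\prod_{j=1}^{n_q}\lambda_{q,j}\Big)^{(-1)^q q}\Big]^{-1}.$$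
   Context: For ordered bases $X,Y$ of a finite-dimensional space, $[Y/X]$ is the number with $\wedge Y=[Y/X]\wedge X$ (ordered wedge products). Let $B^q=dC^{q-1}$, $B_q=d^*C^{q+1}$. When $H^*(C^*,d)=0$ and $H_*(C^*,d^* )=0$, the algebraic torsion is defined as follows: choose ordered bases $\mathbf b^q$ of $B^q$ and lifts $\tilde{\mathbf b}^q\subset C^{q-1}$ with $d\tilde{\mathbf b}^q=\mathbf b^q$, ordered bases $\mathbf b_q$ of $B_q$ and lifts $\tilde{\mathbf b}_q\subset C^{q+1}$ with $d^*\tilde{\mathbf b}_q=\mathbf b_q$; then $$torsion(C^*,d,d^* )=(-1)^{S}\prod_q[\mathbf b^q,\tilde{\mathbf b}^{q+1}/\mathbf b_q,\tilde{\mathbf b}_{q-1}]^{(-1)^{q+1}},\qquad S=\sum_q\dim B_{q-1}\dim B^{q+1},$$ independent of the choices. *)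

theory Defs
  imports "Jordan_Normal_Form.Char_Poly"
begin

locale complex_space = vector_space scale
  for scale :: "complex \<Rightarrow> 'v::ab_group_add \<Rightarrow> 'v"
begin

definition ordered_basis :: "'v set \<Rightarrow> 'v list \<Rightarrow> bool" where
  "ordered_basis U X \<longleftrightarrow> distinct X \<and> independent (set X) \<and> span (set X) = U"

text \<open>
  The exterior power of degree n is not in the library. It is modelled here as the space of
  functionals on the alternating n-linear forms, the pure wedge of vectors being evaluation at
  these vectors; in finite dimension this is the exterior power up to canonical isomorphism.
  Forms on n-tuples are functions on lists, of which only the values on lists of length n matter.
\<close>

definition alternating_form :: "nat \<Rightarrow> ('v list \<Rightarrow> complex) \<Rightarrow> bool" where
  "alternating_form n \<omega> \<longleftrightarrow>
     (\<forall>xs ys v w. length xs + length ys + 1 = n \<longrightarrow>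
        \<omega> (xs @ (v + w) # ys) = \<omega> (xs @ v # ys) + \<omega> (xs @ w # ys)) \<and>
     (\<forall>xs ys c v. length xs + length ys + 1 = n \<longrightarrow>
        \<omega> (xs @ scale c v # ys) = c * \<omega> (xs @ v # ys)) \<and>
     (\<forall>xs. length xs = n \<and> \<not> distinct xs \<longrightarrow> \<omega> xs = 0)"

definition wedge :: "'v list \<Rightarrow> ('v list \<Rightarrow> complex) \<Rightarrow> complex" where
  "wedge X = (\<lambda>\<omega>. if alternating_form (length X) \<omega> then \<omega> X else 0)"

text \<open>The number [Y/X].\<close>

definition wedge_ratio :: "'v list \<Rightarrow> 'v list \<Rightarrow> complex" where
  "wedge_ratio Y X = (THE c. wedge Y = (\<lambda>\<omega>. c * wedge X \<omega>))"

text \<open>Column j of the matrix holds the coordinates of the image of the j-th basis vector.\<close>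

definition matrix_wrt :: "'v list \<Rightarrow> ('v \<Rightarrow> 'v) \<Rightarrow> complex mat" where
  "matrix_wrt X f =
     mat (length X) (length X) (\<lambda>(i, j). representation (set X) (f (X ! j)) (X ! i))"

text \<open>
  Determinant and characteristic polynomial of the restriction of f to a finite-dimensional
  f-invariant subspace U: the common value for all ordered bases of U.
\<close>

definition lin_det :: "'v set \<Rightarrow> ('v \<Rightarrow> 'v) \<Rightarrow> complex" where
  "lin_det U f = (THE c. \<exists>X. ordered_basis U X \<and> c = det (matrix_wrt X f))"

definition lin_char_poly :: "'v set \<Rightarrow> ('v \<Rightarrow> 'v) \<Rightarrow> complex poly" where
  "lin_char_poly U f = (THE p. \<exists>X. ordered_basis U X \<and> p = char_poly (matrix_wrt X f))"

definition algebraic_multiplicity :: "'v set \<Rightarrow> ('v \<Rightarrow> 'v) \<Rightarrow> complex \<Rightarrow> nat" where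
  "algebraic_multiplicity U f \<mu> = Polynomial.order \<mu> (lin_char_poly U f)"

definition is_eigenvalue :: "('v \<Rightarrow> 'v) \<Rightarrow> complex \<Rightarrow> bool" where
  "is_eigenvalue f \<mu> \<longleftrightarrow> (\<exists>v. v \<noteq> 0 \<and> f v = scale \<mu> v)"

end

text \<open>
  The ambient type is the total space, and the grading is indexed by the integers, with zero
  components outside the degrees 0, ..., N, so that the degrees -1 and N + 1 need no special
  treatment. The map ds is the map d* of degree -1; no inner product is involved.
\<close>

locale graded_complex = complex_space scale
  for scale :: "complex \<Rightarrow> 'v::ab_group_add \<Rightarrow> 'v" +
  fixes N :: nat and C :: "int \<Rightarrow> 'v set" and d ds :: "'v \<Rightarrow> 'v"
  assumes finite_dimensional: "\<exists>B. finite B \<and> span B = UNIV"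
    and subspace_C: "\<And>q. subspace (C q)"
    and C_outside: "\<And>q. q < 0 \<or> q > int N \<Longrightarrow> C q = {0}"
    and direct_sum: "\<And>v. \<exists>!x. (\<forall>q. x q \<in> C q) \<and> v = (\<Sum>q = 0..int N. x q)"
    and linear_d: "Vector_Spaces.linear scale scale d"
    and d_degree: "\<And>q. d ` C q \<subseteq> C (q + 1)"
    and d_d: "\<And>v. d (d v) = 0"
    and linear_ds: "Vector_Spaces.linear scale scale ds"
    and ds_degree: "\<And>q. ds ` C q \<subseteq> C (q - 1)"
    and ds_ds: "\<And>v. ds (ds v) = 0"
begin

definition laplacian :: "'v \<Rightarrow> 'v" where
  "laplacian v = d (ds v) + ds (d v)"

definition upper_B :: "int \<Rightarrow> 'v set" where
  "upper_B q = d ` C (q - 1)"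

definition lower_B :: "int \<Rightarrow> 'v set" where
  "lower_B q = ds ` C (q + 1)"

definition upper_Z :: "int \<Rightarrow> 'v set" where
  "upper_Z q = {v \<in> C q. d v = 0}"

definition lower_Z :: "int \<Rightarrow> 'v set" where
  "lower_Z q = {v \<in> C q. ds v = 0}"

definition cohomology :: "int \<Rightarrow> 'v set set" where
  "cohomology q = upper_Z q // {(x, y). x \<in> upper_Z q \<and> y \<in> upper_Z q \<and> x - y \<in> upper_B q}"

definition homology :: "int \<Rightarrow> 'v set set" where
  "homology q = lower_Z q // {(x, y). x \<in> lower_Z q \<and> y \<in> lower_Z q \<and> x - y \<in> lower_B q}"

text \<open>
  The families bu and bd are the ordered bases of the spaces upper_B and lower_B, and lu and ld
  are their lifts, indexed by the degree of the basis lifted: lu q lies in degree q - 1 and ld q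
  in degree q + 1.
\<close>

definition torsion_choice ::
  "(int \<Rightarrow> 'v list) \<Rightarrow> (int \<Rightarrow> 'v list) \<Rightarrow> (int \<Rightarrow> 'v list) \<Rightarrow> (int \<Rightarrow> 'v list) \<Rightarrow> bool" where
  "torsion_choice bu lu bd ld \<longleftrightarrow> (\<forall>q.
     ordered_basis (upper_B q) (bu q) \<and> set (lu q) \<subseteq> C (q - 1) \<and> map d (lu q) = bu q \<and>
     ordered_basis (lower_B q) (bd q) \<and> set (ld q) \<subseteq> C (q + 1) \<and> map ds (ld q) = bd q)"

definition torsion_sign_exponent :: nat where
  "torsion_sign_exponent = (\<Sum>q = 0..N. dim (lower_B (int q - 1)) * dim (upper_B (int q + 1)))"

definition torsion_value ::
  "(int \<Rightarrow> 'v list) \<Rightarrow> (int \<Rightarrow> 'v list) \<Rightarrow> (int \<Rightarrow> 'v list) \<Rightarrow> (int \<Rightarrow> 'v list) \<Rightarrow> complex" where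
  "torsion_value bu lu bd ld =
     (- 1) ^ torsion_sign_exponent *
     (\<Prod>q = 0..N. wedge_ratio (bu (int q) @ lu (int q + 1)) (bd (int q) @ ld (int q - 1))
        powi ((- 1) ^ (q + 1)))"

text \<open>
  Meaningful when the cohomology and the homology vanish: all admissible choices of bases and
  lifts then give the same value.
\<close>

definition torsion :: complex where
  "torsion = (THE t. \<exists>bu lu bd ld. torsion_choice bu lu bd ld \<and> t = torsion_value bu lu bd ld)"

end

end

theory Submission
  imports Defs
begin

text \<open>
  The Laplacian is invertible and commutes with d and ds. Hence C q is the direct sum of
  upper_B q and lower_B q, and d maps lower_B q isomorphically onto upper_B (q + 1). Let D q be
  the determinant of the Laplacian on upper_B (q + 1), which is also its determinant on lower_B q;
  then its determinant on C q is D q * D (q - 1). In the factor of the torsion in degree q, the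
  lifts may be moved into the complementary summand of C q. If Y denotes the lift of bd (q - 1) to
  upper_B q, then d maps bd (q - 1) to the image of Y under the Laplacian, so that the factor is
  D (q - 1) up to a sign and to change-of-basis factors e (q - 1) * e q, which cancel in the
  alternating product.
\<close>

section \<open>Alternating forms and change of basis\<close>

text \<open>The weights q disappear by an Abel summation: D q enters the determinant on
  \<open>C q\<close> with exponent (-1)^q q and the one on \<open>C (q + 1)\<close> with exponent
  (-1)^(q+1) (q + 1), which leaves (-1)^(q+1). Inverted, this is (-1)^q, the exponent of the torsion
  factor in degree q + 1, the one that contains D q. The sign S compensates the exchange of the two
  blocks of the denominator basis, because \<open>upper_B (q + 1)\<close> and
  \<open>lower_B q\<close> have the same dimension. The change-of-basis factors cancel without
  remainder because the spaces at both ends of the complex are zero. As [Y/X] is defined by testing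
  against alternating forms, a ratio is found by rewriting the value of an arbitrary form block by
  block; a form that does not vanish on the reference basis then makes the ratio unique. The place
  of an inner product in Hodge theory is taken by finite dimension: the injective Laplacian maps
  every invariant subspace onto itself, which gives both acyclicity and the splitting.\<close>

context complex_space
begin

lemma alternating_form_add:
  assumes "alternating_form n \<omega>" "length xs + length ys + 1 = n"
  shows "\<omega> (xs @ (v + w) # ys) = \<omega> (xs @ v # ys) + \<omega> (xs @ w # ys)"
  using assms unfolding alternating_form_def by blast

lemma alternating_form_scale:
  assumes "alternating_form n \<omega>" "length xs + length ys + 1 = n"
  shows "\<omega> (xs @ scale c v # ys) = c * \<omega> (xs @ v # ys)"
  using assms unfolding alternating_form_def by blast

lemma alternating_form_not_distinct:
  assumes "alternating_form n \<omega>" "length xs = n" "\<not> distinct xs"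
  shows "\<omega> xs = 0"
  using assms unfolding alternating_form_def by blast

lemma alternating_form_subspace:
  assumes "alternating_form n \<omega>" "length xs + length ys + 1 = n"
  shows "subspace {v. \<omega> (xs @ v # ys) = 0}"
proof (rule subspaceI)
  show "0 \<in> {v. \<omega> (xs @ v # ys) = 0}"
    using alternating_form_scale[OF assms, of 0 0] by simp
qed (use alternating_form_add[OF assms] alternating_form_scale[OF assms] in auto)

lemma alternating_form_span:
  assumes \<omega>: "alternating_form n \<omega>" and n: "length xs + length ys + 1 = n"
    and v: "v \<in> span S" and S: "\<And>s. s \<in> S \<Longrightarrow> \<omega> (xs @ s # ys) = 0"
  shows "\<omega> (xs @ v # ys) = 0"
proof -
  have "span S \<subseteq> {v. \<omega> (xs @ v # ys) = 0}"
    by (rule span_minimal[OF _ alternating_form_subspace[OF \<omega> n]]) (use S in auto)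
  then show ?thesis using v by auto
qed

text \<open>Alternation is defined by vanishing on repeated entries; polarizing with
  \<open>a + b\<close> in both slots turns it into antisymmetry.\<close>

lemma alternating_form_swap_adjacent:
  assumes \<omega>: "alternating_form n \<omega>" and n: "length xs + length ys + 2 = n"
  shows "\<omega> (xs @ a # b # ys) = - \<omega> (xs @ b # a # ys)"
proof -
  have zero: "\<omega> (xs @ c # c # ys) = 0" for c
    by (rule alternating_form_not_distinct[OF \<omega>]) (use n in auto)
  have left: "\<omega> (xs @ (v + w) # c # ys) = \<omega> (xs @ v # c # ys) + \<omega> (xs @ w # c # ys)" for v w c
    by (rule alternating_form_add[OF \<omega>, of xs "c # ys"]) (use n in auto)
  have right: "\<omega> (xs @ c # (v + w) # ys) = \<omega> (xs @ c # v # ys) + \<omega> (xs @ c # w # ys)" for v w c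
    using alternating_form_add[OF \<omega>, of "xs @ [c]" ys] n by auto
  have "0 = \<omega> (xs @ (a + b) # (a + b) # ys)" by (simp only: zero)
  also have "\<dots> = \<omega> (xs @ a # b # ys) + \<omega> (xs @ b # a # ys)"
    by (simp only: left right) (simp add: zero)
  finally show ?thesis using eq_neg_iff_add_eq_0 by metis
qed

lemma alternating_form_move:
  assumes \<omega>: "alternating_form n \<omega>"
  shows "length xs + length zs + length ys + 1 = n \<Longrightarrow>
    \<omega> (xs @ a # zs @ ys) = (- 1) ^ length zs * \<omega> (xs @ zs @ a # ys)"
proof (induction zs arbitrary: xs)
  case (Cons z zs)
  have "\<omega> (xs @ a # (z # zs) @ ys) = - \<omega> ((xs @ [z]) @ a # zs @ ys)"
    using alternating_form_swap_adjacent[OF \<omega>, of xs "zs @ ys" a z] Cons.prems by simp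
  also have "\<dots> = - ((- 1) ^ length zs * \<omega> ((xs @ [z]) @ zs @ a # ys))"
    by (subst Cons.IH) (use Cons.prems in auto)
  finally show ?case by simp
qed auto

lemma alternating_form_swap:
  assumes \<omega>: "alternating_form n \<omega>"
  shows "length xs + length ys = n \<Longrightarrow>
    \<omega> (xs @ ys) = (- 1) ^ (length xs * length ys) * \<omega> (ys @ xs)"
proof (induction xs arbitrary: ys)
  case (Cons x xs)
  have "\<omega> ((x # xs) @ ys) = (- 1) ^ length xs * \<omega> (xs @ x # ys)"
    using alternating_form_move[OF \<omega>, of "[]" xs ys x] Cons.prems by simp
  \<comment> \<open>Here \<open>x\<close> joins the second block. The extra factor (-1)^(length xs)
    that this produces cancels the one from moving \<open>x\<close> across
    \<open>xs\<close>.\<close>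
  also have "\<omega> (xs @ x # ys) = (- 1) ^ (length xs * length (x # ys)) * \<omega> ((x # ys) @ xs)"
    using Cons.prems by (intro Cons.IH) simp
  also have "\<omega> ((x # ys) @ xs) = (- 1) ^ length ys * \<omega> (ys @ x # xs)"
    using alternating_form_move[OF \<omega>, of "[]" ys xs x] Cons.prems by simp
  finally show ?case by (simp add: power_add flip: power_mult_distrib)
qed auto

text \<open>Only vanishing is tracked, so the sign of the permutation never has to be
  computed.\<close>

lemma alternating_form_permute_eq_0:
  assumes \<omega>: "alternating_form n \<omega>"
  shows "mset Y = mset X \<Longrightarrow> length xs + length X = n \<Longrightarrow> \<omega> (xs @ X) = 0 \<Longrightarrow> \<omega> (xs @ Y) = 0"
proof (induction X arbitrary: Y xs)
  case (Cons x X)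
  have "x \<in> set Y" using mset_eq_setD[OF Cons.prems(1)] by simp
  then obtain Y1 Y2 where Y: "Y = Y1 @ x # Y2" by (meson split_list)
  then have m: "mset (Y1 @ Y2) = mset X" using Cons.prems(1) by simp
  have "length (Y1 @ Y2) = length X" by (rule mset_eq_length[OF m])
  then have n: "length xs + length Y1 + length Y2 + 1 = n" using Cons.prems(2) by simp
  have "\<omega> ((xs @ [x]) @ Y1 @ Y2) = 0"
    by (rule Cons.IH[OF m]) (use Cons.prems(2,3) in simp_all)
  then show ?case
    using alternating_form_move[OF \<omega> n, of x] unfolding Y by simp
qed simp

text \<open>Rigidity of forms of top degree on the span of \<open>X\<close>: two of them that agree
  on \<open>X\<close> agree everywhere, which later replaces an expansion over permutations.\<close>

lemma alternating_form_eq_0_on_span: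
  assumes \<omega>: "alternating_form n \<omega>" and X: "length X = n" "\<omega> X = 0"
    and Y: "length Y = n" "set Y \<subseteq> span (set X)"
  shows "\<omega> Y = 0"
proof -
  have base: "\<omega> ys = 0" if ys: "length ys = n" "set ys \<subseteq> set X" for ys
  proof (cases "distinct ys")
    case True
    have "card (set ys) = n" using True ys(1) distinct_card by blast
    moreover have "card (set X) \<le> n" using X(1) card_length by blast
    ultimately have eq: "set ys = set X" using ys(2) by (simp add: card_seteq)
    then have "distinct X" using X(1) \<open>card (set ys) = n\<close> by (simp add: card_distinct)
    then have "mset ys = mset X" using True eq set_eq_iff_mset_eq_distinct by blast
    then show ?thesis using alternating_form_permute_eq_0[OF \<omega>, of ys X "[]"] X by simp
  qed (use alternating_form_not_distinct[OF \<omega> ys(1)] in simp)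
  \<comment> \<open>Hybrid lists, with arbitrary span vectors in front and entries of
    \<open>X\<close> behind. The last span vector is replaced by generators, which then belong to
    the rear part.\<close>
  have "length xs + length ys = n \<Longrightarrow> set xs \<subseteq> span (set X) \<Longrightarrow> set ys \<subseteq> set X \<Longrightarrow> \<omega> (xs @ ys) = 0"
    for xs ys
  proof (induction xs arbitrary: ys rule: rev_induct)
    case (snoc v xs)
    have "\<omega> (xs @ v # ys) = 0"
      by (rule alternating_form_span[OF \<omega>, of _ _ _ "set X"]) (use snoc in auto)
    then show ?case by simp
  qed (use base in auto)
  from this[of Y "[]"] show ?thesis using Y by simp
qed

text \<open>Freezing one block leaves a form in the other, so that a change of basis can be made in
  each block of a concatenation separately.\<close>

lemma alternating_form_append_left:
  assumes \<omega>: "alternating_form n \<omega>" and n: "n = m + length ys"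
  shows "alternating_form m (\<lambda>xs. \<omega> (xs @ ys))"
  unfolding alternating_form_def
proof (intro conjI allI impI)
  fix xs zs :: "'v list" and v w assume l: "length xs + length zs + 1 = m"
  show "\<omega> ((xs @ (v + w) # zs) @ ys) = \<omega> ((xs @ v # zs) @ ys) + \<omega> ((xs @ w # zs) @ ys)"
    using alternating_form_add[OF \<omega>, of xs "zs @ ys" v w] l n by simp
next
  fix xs zs :: "'v list" and c v assume l: "length xs + length zs + 1 = m"
  show "\<omega> ((xs @ scale c v # zs) @ ys) = c * \<omega> ((xs @ v # zs) @ ys)"
    using alternating_form_scale[OF \<omega>, of xs "zs @ ys" c v] l n by simp
next
  fix xs :: "'v list" assume "length xs = m \<and> \<not> distinct xs"
  then show "\<omega> (xs @ ys) = 0" using n by (intro alternating_form_not_distinct[OF \<omega>]) auto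
qed

lemma alternating_form_append_right:
  assumes \<omega>: "alternating_form n \<omega>" and n: "n = length xs + m"
  shows "alternating_form m (\<lambda>ys. \<omega> (xs @ ys))"
  unfolding alternating_form_def
proof (intro conjI allI impI)
  fix ys zs :: "'v list" and v w assume l: "length ys + length zs + 1 = m"
  show "\<omega> (xs @ (ys @ (v + w) # zs)) = \<omega> (xs @ (ys @ v # zs)) + \<omega> (xs @ (ys @ w # zs))"
    using alternating_form_add[OF \<omega>, of "xs @ ys" zs v w] l n by simp
next
  fix ys zs :: "'v list" and c v assume l: "length ys + length zs + 1 = m"
  show "\<omega> (xs @ (ys @ scale c v # zs)) = c * \<omega> (xs @ (ys @ v # zs))"
    using alternating_form_scale[OF \<omega>, of "xs @ ys" zs c v] l n by simp
next
  fix ys :: "'v list" assume "length ys = m \<and> \<not> distinct ys"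
  then show "\<omega> (xs @ ys) = 0" using n by (intro alternating_form_not_distinct[OF \<omega>]) auto
qed

text \<open>Since \<open>xs\<close> is among the arguments, a summand from its span only contributes
  terms with a repeated entry. This is what makes lifts replaceable by other lifts. The block
  \<open>zs\<close> collects the entries already replaced during the induction.\<close>

lemma alternating_form_shift:
  assumes \<omega>: "alternating_form n \<omega>" and diff: "list_all2 (\<lambda>y y'. y - y' \<in> span (set xs)) ys ys'"
  shows "length xs + length zs + length ys = n \<Longrightarrow> \<omega> (xs @ zs @ ys) = \<omega> (xs @ zs @ ys')"
  using diff
proof (induction ys ys' arbitrary: zs rule: list_all2_induct)
  case (Cons y ys y' ys')
  have "\<omega> ((xs @ zs) @ (y - y') # ys) = 0"
    by (rule alternating_form_span[OF \<omega> _ Cons.hyps(1)])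
      (use Cons.prems in \<open>auto intro!: alternating_form_not_distinct[OF \<omega>]\<close>)
  then have "\<omega> (xs @ zs @ y # ys) = \<omega> (xs @ zs @ y' # ys)"
    using alternating_form_add[OF \<omega>, of "xs @ zs" ys y' "y - y'"] Cons.prems by simp
  also have "\<dots> = \<omega> (xs @ zs @ y' # ys')"
    using Cons.IH[of "zs @ [y']"] Cons.prems by simp
  finally show ?case .
qed auto

section \<open>Coordinate matrices\<close>

definition coord_mat :: "'v list \<Rightarrow> 'v list \<Rightarrow> complex mat" where
  "coord_mat X Y = mat (length X) (length Y) (\<lambda>(i, j). representation (set X) (Y ! j) (X ! i))"

lemma coord_mat_carrier [simp]: "coord_mat X Y \<in> carrier_mat (length X) (length Y)"
  by (simp add: coord_mat_def)

lemma matrix_wrt_eq_coord_mat: "matrix_wrt X f = coord_mat X (map f X)"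
  by (rule eq_matI) (auto simp: matrix_wrt_def coord_mat_def)

lemma sum_nth_representation_eq:
  assumes "distinct Y" "independent (set Y)" "z \<in> span (set Y)"
  shows "(\<Sum>k<length Y. scale (representation (set Y) z (Y ! k)) (Y ! k)) = z"
proof -
  have "(\<Sum>k<length Y. scale (representation (set Y) z (Y ! k)) (Y ! k))
      = (\<Sum>y\<in>set Y. scale (representation (set Y) z y) y)"
    by (rule sum.reindex_bij_betw) (use bij_betw_nth[OF assms(1) refl refl] in auto)
  then show ?thesis using sum_representation_eq assms by simp
qed

text \<open>Expand the entries of \<open>Z\<close> in \<open>Y\<close> and apply \<open>f\<close>.
  With \<open>f = id\<close> this is the base change formula.\<close>

lemma coord_mat_map:
  assumes W: "independent (set W)" and Y: "distinct Y" "independent (set Y)"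
    and Z: "set Z \<subseteq> span (set Y)"
    and f: "Vector_Spaces.linear scale scale f" "f ` set Y \<subseteq> span (set W)"
  shows "coord_mat W (map f Z) = coord_mat W (map f Y) * coord_mat Y Z"
proof (rule eq_matI)
  interpret f: Vector_Spaces.linear scale scale f by (rule f)
  fix i j assume "i < dim_row (coord_mat W (map f Y) * coord_mat Y Z)"
    and "j < dim_col (coord_mat W (map f Y) * coord_mat Y Z)"
  then have i: "i < length W" and j: "j < length Z" by (auto simp: coord_mat_def)
  define r where "r k = representation (set Y) (Z ! j) (Y ! k)" for k
  have in_span: "f (Y ! k) \<in> span (set W)" if "k < length Y" for k
    using f(2) that by auto
  have "Z ! j = (\<Sum>k<length Y. scale (r k) (Y ! k))"
    unfolding r_def using sum_nth_representation_eq[OF Y, of "Z ! j"] Z j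
    by (simp add: subset_iff)
  then have "f (Z ! j) = (\<Sum>k<length Y. scale (r k) (f (Y ! k)))"
    by (simp add: f.sum f.scale)
  moreover have "representation (set W) (\<Sum>k<length Y. scale (r k) (f (Y ! k)))
      = (\<lambda>b. \<Sum>k<length Y. representation (set W) (scale (r k) (f (Y ! k))) b)"
    using in_span by (intro representation_sum[OF W]) (auto intro: span_scale)
  ultimately have "representation (set W) (f (Z ! j)) (W ! i)
      = (\<Sum>k<length Y. r k * representation (set W) (f (Y ! k)) (W ! i))"
    using in_span by (simp add: representation_scale[OF W])
  then show "coord_mat W (map f Z) $$ (i, j) = (coord_mat W (map f Y) * coord_mat Y Z) $$ (i, j)"
    using i j by (simp add: coord_mat_def scalar_prod_def r_def atLeast0LessThan mult.commute)
qed (auto simp: coord_mat_def)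

lemma coord_mat_mult:
  assumes "independent (set W)" "distinct Y" "independent (set Y)"
    and "set Z \<subseteq> span (set Y)" "set Y \<subseteq> span (set W)"
  shows "coord_mat W Z = coord_mat W Y * coord_mat Y Z"
  using coord_mat_map[OF assms(1-4), of id] linear_id assms(5) by simp

lemma coord_mat_self:
  assumes "distinct X" "independent (set X)"
  shows "coord_mat X X = 1\<^sub>m (length X)"
  by (rule eq_matI)
    (use assms in \<open>auto simp: coord_mat_def representation_basis nth_eq_iff_index_eq\<close>)

text \<open>The case \<open>W = map f Y\<close> of \<open>coord_mat_map\<close>, where the first
  matrix factor is the identity.\<close>

lemma coord_mat_map_inj:
  assumes "distinct (map f Y)" "independent (set (map f Y))" "distinct Y" "independent (set Y)"
    and "set Z \<subseteq> span (set Y)" "Vector_Spaces.linear scale scale f"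
  shows "coord_mat (map f Y) (map f Z) = coord_mat Y Z"
proof -
  have "coord_mat (map f Y) (map f Z) = coord_mat (map f Y) (map f Y) * coord_mat Y Z"
    by (rule coord_mat_map) (use assms in \<open>auto intro: span_base\<close>)
  also have "\<dots> = coord_mat Y Z"
    unfolding coord_mat_self[OF assms(1,2)]
    using left_mult_one_mat[OF coord_mat_carrier[of Y Z]] by simp
  finally show ?thesis .
qed

section \<open>The determinant as an alternating form\<close>

lemma det_column_expansion:
  fixes g :: "'v \<Rightarrow> nat \<Rightarrow> complex"
  assumes "length xs + length ys + 1 = n"
  shows "\<exists>c. \<forall>v. det (mat n n (\<lambda>(i, j). g ((xs @ v # ys) ! j) i)) = (\<Sum>i<n. g v i * c i)"
proof -
  define A where "A v = mat n n (\<lambda>(i, j). g ((xs @ v # ys) ! j) i)" for v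
  define j where "j = length xs"
  have j: "j < n" using assms by (simp add: j_def)
  have A: "A v \<in> carrier_mat n n" for v by (simp add: A_def)
  \<comment> \<open>Deleting column \<open>j\<close> removes the only column that depends on
    \<open>v\<close>; the cofactors along it are therefore constants, and they serve as
    \<open>c\<close>.\<close>
  have "mat_delete (A v) i j = mat_delete (A 0) i j" for v i
    by (rule eq_matI) (use j in \<open>auto simp: mat_delete_def A_def nth_append j_def nth_Cons split: nat.split\<close>)
  then have cof: "cofactor (A v) i j = cofactor (A 0) i j" for v i unfolding cofactor_def by metis
  have "det (A v) = (\<Sum>i<n. g v i * cofactor (A 0) i j)" for v
  proof -
    have "det (A v) = (\<Sum>i<n. A v $$ (i, j) * cofactor (A v) i j)"
      by (rule laplace_expansion_column[OF A j])
    also have "\<dots> = (\<Sum>i<n. g v i * cofactor (A 0) i j)"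
      using j cof[of v] by (intro sum.cong) (auto simp: A_def j_def)
    finally show ?thesis .
  qed
  then show ?thesis
    unfolding A_def[symmetric] by (intro exI[of _ "\<lambda>i. cofactor (A 0) i j"] allI)
qed

lemma alternating_form_det:
  assumes add: "\<And>v w i. g (v + w) i = g v i + g w i"
    and scale: "\<And>c v i. g (scale c v) i = c * g v i"
  shows "alternating_form n (\<lambda>Y. det (mat n n (\<lambda>(i, j). g (Y ! j) i)))"
  unfolding alternating_form_def
proof (intro conjI allI impI)
  fix xs ys :: "'v list" and v w assume "length xs + length ys + 1 = n"
  then obtain c where "\<And>v. det (mat n n (\<lambda>(i, j). g ((xs @ v # ys) ! j) i)) = (\<Sum>i<n. g v i * c i)"
    using det_column_expansion[of xs ys n g] by blast
  then show "det (mat n n (\<lambda>(i, j). g ((xs @ (v + w) # ys) ! j) i)) =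
      det (mat n n (\<lambda>(i, j). g ((xs @ v # ys) ! j) i)) +
      det (mat n n (\<lambda>(i, j). g ((xs @ w # ys) ! j) i))"
    by (simp add: add distrib_right sum.distrib)
next
  fix xs ys :: "'v list" and a v assume "length xs + length ys + 1 = n"
  then obtain c where "\<And>v. det (mat n n (\<lambda>(i, j). g ((xs @ v # ys) ! j) i)) = (\<Sum>i<n. g v i * c i)"
    using det_column_expansion[of xs ys n g] by blast
  then show "det (mat n n (\<lambda>(i, j). g ((xs @ scale a v # ys) ! j) i)) =
      a * det (mat n n (\<lambda>(i, j). g ((xs @ v # ys) ! j) i))"
    by (simp add: scale sum_distrib_left mult.assoc)
next
  fix xs :: "'v list" assume "length xs = n \<and> \<not> distinct xs"
  then obtain i j where "i \<noteq> j" "i < n" "j < n" "xs ! i = xs ! j"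
    by (auto simp: distinct_conv_nth)
  then show "det (mat n n (\<lambda>(i, j). g (xs ! j) i)) = 0"
    by (intro det_identical_columns[of _ n i j]) (auto intro: eq_vecI)
qed

text \<open>\<open>representation (set X)\<close> is zero by convention outside the span of
  \<open>X\<close>, hence not additive on the whole space. A form must be multilinear everywhere, so
  coordinates are taken in a basis \<open>E\<close> of the whole space extending \<open>X\<close>,
  which agrees with \<open>X\<close> on the span.\<close>

lemma alternating_form_coord_mat:
  assumes X: "distinct X" "independent (set X)"
  obtains \<delta> where "alternating_form (length X) \<delta>"
    "\<And>Y. length Y = length X \<Longrightarrow> set Y \<subseteq> span (set X) \<Longrightarrow> \<delta> Y = det (coord_mat X Y)"
proof
  define E where "E = extend_basis (set X)"
  have E: "set X \<subseteq> E" "independent E" "span E = UNIV"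
    using X extend_basis_superset independent_extend_basis span_extend_basis unfolding E_def by auto
  define \<delta> where "\<delta> Y = det (mat (length X) (length X) (\<lambda>(i, j). representation E (Y ! j) (X ! i)))" for Y
  show "alternating_form (length X) \<delta>"
    unfolding \<delta>_def
    by (rule alternating_form_det) (use E in \<open>auto simp: representation_add representation_scale\<close>)
  fix Y assume Y: "length Y = length X" "set Y \<subseteq> span (set X)"
  have "mat (length X) (length X) (\<lambda>(i, j). representation E (Y ! j) (X ! i)) = coord_mat X Y"
    by (rule eq_matI)
      (use Y representation_extend[OF E(2) _ E(1)] in \<open>auto simp: coord_mat_def subset_iff\<close>)
  then show "\<delta> Y = det (coord_mat X Y)" by (simp add: \<delta>_def)
qed

lemma alternating_form_change_basis:
  assumes \<omega>: "alternating_form (length X) \<omega>" and X: "distinct X" "independent (set X)"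
    and Y: "length Y = length X" "set Y \<subseteq> span (set X)"
  shows "\<omega> Y = det (coord_mat X Y) * \<omega> X"
proof -
  obtain \<delta> where \<delta>: "alternating_form (length X) \<delta>"
    and \<delta>_eq: "\<And>Y. length Y = length X \<Longrightarrow> set Y \<subseteq> span (set X) \<Longrightarrow> \<delta> Y = det (coord_mat X Y)"
    using alternating_form_coord_mat[OF X] by blast
  have "\<delta> X = 1" using \<delta>_eq[of X] coord_mat_self[OF X] by (simp add: span_superset)
  \<comment> \<open>This form vanishes on X, hence on the whole span; no Leibniz expansion is needed.\<close>
  define \<eta> where "\<eta> Y = \<omega> Y - \<delta> Y * \<omega> X" for Y
  have "alternating_form (length X) \<eta>"
    unfolding alternating_form_def \<eta>_def
    using alternating_form_not_distinct[OF \<omega>] alternating_form_not_distinct[OF \<delta>]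
    by (simp add: alternating_form_add[OF \<omega>] alternating_form_add[OF \<delta>]
        alternating_form_scale[OF \<omega>] alternating_form_scale[OF \<delta>] algebra_simps)
  then have "\<eta> Y = 0"
    by (rule alternating_form_eq_0_on_span[OF _ refl _ Y]) (simp add: \<eta>_def \<open>\<delta> X = 1\<close>)
  then show ?thesis using \<delta>_eq[OF Y] by (simp add: \<eta>_def)
qed

lemma alternating_form_nonzero:
  assumes X: "distinct X" "independent (set X)"
  obtains \<omega> where "alternating_form (length X) \<omega>" "\<omega> X = 1"
proof -
  obtain \<delta> where "alternating_form (length X) \<delta>"
    "\<And>Y. length Y = length X \<Longrightarrow> set Y \<subseteq> span (set X) \<Longrightarrow> \<delta> Y = det (coord_mat X Y)"
    using alternating_form_coord_mat[OF X] by blast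
  moreover from this(2)[of X] have "\<delta> X = 1" using coord_mat_self[OF X] by (simp add: span_superset)
  ultimately show ?thesis using that by blast
qed

text \<open>Equal lengths ensure that both wedges are tested on the same forms; the form in
  \<open>nz\<close> excludes any second ratio.\<close>

lemma wedge_ratio_eqI:
  assumes len: "length Y = length X"
    and eq: "\<And>\<omega>. alternating_form (length X) \<omega> \<Longrightarrow> \<omega> Y = c * \<omega> X"
    and nz: "alternating_form (length X) \<omega>" "\<omega> X \<noteq> 0"
  shows "wedge_ratio Y X = c"
  unfolding wedge_ratio_def
proof (rule the_equality)
  show "wedge Y = (\<lambda>\<omega>. c * wedge X \<omega>)" using len eq by (auto simp: wedge_def)
  fix c' assume "wedge Y = (\<lambda>\<omega>. c' * wedge X \<omega>)"
  from fun_cong[OF this, of \<omega>] have "\<omega> Y = c' * \<omega> X" using nz len by (simp add: wedge_def)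
  then show "c' = c" using eq[OF nz(1)] nz(2) by simp
qed

lemma alternating_form_change_left:
  assumes \<omega>: "alternating_form n \<omega>" "n = length X + length ys"
    and X: "distinct X" "independent (set X)"
    and Y: "length Y = length X" "set Y \<subseteq> span (set X)"
  shows "\<omega> (Y @ ys) = det (coord_mat X Y) * \<omega> (X @ ys)"
  using alternating_form_change_basis[OF alternating_form_append_left[OF \<omega>] X Y] .

lemma alternating_form_change_right:
  assumes \<omega>: "alternating_form n \<omega>" "n = length xs + length X"
    and X: "distinct X" "independent (set X)"
    and Y: "length Y = length X" "set Y \<subseteq> span (set X)"
  shows "\<omega> (xs @ Y) = det (coord_mat X Y) * \<omega> (xs @ X)"
  using alternating_form_change_basis[OF alternating_form_append_right[OF \<omega>] X Y] .

section \<open>Ordered bases\<close>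

lemma ordered_basisD:
  assumes "ordered_basis U X"
  shows "distinct X" "independent (set X)" "span (set X) = U" "set X \<subseteq> U"
  using assms span_superset[of "set X"] unfolding ordered_basis_def by auto

lemma ordered_basis_length:
  assumes "ordered_basis U X"
  shows "length X = dim U"
proof -
  have "dim U = card (set X)"
    by (rule dim_eq_card) (metis ordered_basisD(3)[OF assms] span_span, rule ordered_basisD(2)[OF assms])
  then show ?thesis using ordered_basisD(1)[OF assms] by (simp add: distinct_card)
qed

lemma ordered_basis_zero:
  assumes "ordered_basis {0} X"
  shows "X = []"
proof -
  have "set X \<subseteq> {0}" "0 \<notin> set X"
    using ordered_basisD[OF assms] dependent_zero by auto
  then show ?thesis by (cases X) auto
qed

lemma ordered_basis_exists:
  assumes "subspace U" "finite T" "U \<subseteq> span T"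
  shows "\<exists>X. ordered_basis U X"
proof -
  obtain B where B: "B \<subseteq> U" "independent B" "U \<subseteq> span B" using basis_exists by metis
  have "finite B" using independent_span_bound[OF assms(2) B(2)] B(1) assms(3) by auto
  then obtain X where X: "set X = B" "distinct X" using finite_distinct_list by metis
  have "span B = U" using span_minimal[OF B(1) assms(1)] B(3) by auto
  then show ?thesis using X B unfolding ordered_basis_def by metis
qed

lemma ordered_basis_map:
  assumes f: "Vector_Spaces.linear scale scale f" "inj_on f U" and X: "ordered_basis U X"
  shows "ordered_basis (f ` U) (map f X)"
proof -
  interpret f: Vector_Spaces.linear scale scale f by (rule f)
  note X = ordered_basisD[OF X]
  have "distinct (map f X)" using X f(2) by (auto simp: distinct_map intro: inj_on_subset)
  moreover have "independent (f ` set X)"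
    using f.independent_inj_on_image[of "set X"] X f(2) by auto
  moreover have "span (f ` set X) = f ` U" using f.span_image X by metis
  ultimately show ?thesis by (simp add: ordered_basis_def)
qed

lemma ordered_basis_lift:
  assumes f: "Vector_Spaces.linear scale scale f" "inj_on f U"
    and U: "subspace U" and X: "ordered_basis (f ` U) X"
  obtains Y where "ordered_basis U Y" "map f Y = X"
proof -
  interpret vector_space_pair scale scale by unfold_locales
  obtain g where g: "Vector_Spaces.linear scale scale g" "\<And>v. v \<in> U \<Longrightarrow> g (f v) = v"
    using linear_exists_left_inverse_on[OF f(1) U f(2)] by blast
  have "inj_on g (f ` U)" using g(2) by (auto intro!: inj_onI)
  moreover have "g ` f ` U = U" using g(2) by force
  ultimately have "ordered_basis U (map g X)" using ordered_basis_map[OF g(1) _ X] by simp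
  moreover have "map f (map g X) = X"
    using ordered_basisD(4)[OF X] g(2) by (auto intro!: map_idI)
  ultimately show ?thesis using that by blast
qed

lemma ordered_basis_append:
  assumes Y: "ordered_basis U Y" and Z: "ordered_basis W Z" and UW: "U \<inter> W = {0}"
  shows "ordered_basis {u + w |u w. u \<in> U \<and> w \<in> W} (Y @ Z)"
proof -
  note Y = ordered_basisD[OF Y] and Z = ordered_basisD[OF Z]
  have disj: "set Y \<inter> set Z = {}"
  proof -
    have "0 \<notin> set Y" using Y(2) dependent_zero by blast
    moreover have "x = 0" if "x \<in> set Y" "x \<in> set Z" for x
      using that Y(4) Z(4) UW by (metis IntI singletonD subsetD)
    ultimately show ?thesis by fast
  qed
  have "independent (set Y \<union> set Z)"
  proof (rule independent_if_scalars_zero)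
    fix c x assume sum: "(\<Sum>x\<in>set Y \<union> set Z. scale (c x) x) = 0" and x: "x \<in> set Y \<union> set Z"
    define u where "u = (\<Sum>x\<in>set Y. scale (c x) x)"
    define w where "w = (\<Sum>x\<in>set Z. scale (c x) x)"
    have "u + w = 0" using sum disj unfolding u_def w_def by (simp add: sum.union_disjoint)
    have "u \<in> span (set Y)" "w \<in> span (set Z)"
      unfolding u_def w_def by (auto intro!: span_sum intro: span_scale span_base)
    then have "u \<in> U" "- w \<in> W" by (simp_all add: span_neg flip: Y(3) Z(3))
    moreover have "u = - w" using \<open>u + w = 0\<close> by (simp add: eq_neg_iff_add_eq_0)
    ultimately have "u \<in> U \<inter> W" by simp
    then have "u = 0" unfolding UW by simp
    then have "w = 0" using \<open>u + w = 0\<close> by simp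
    note uw = \<open>u = 0\<close>[unfolded u_def] \<open>w = 0\<close>[unfolded w_def]
    then show "c x = 0"
      using x independentD[OF Y(2) _ _ uw(1)] independentD[OF Z(2) _ _ uw(2)] by blast
  qed auto
  then show ?thesis
    using Y Z disj unfolding ordered_basis_def by (simp add: span_Un)
qed

lemma ordered_basis_invariant:
  assumes "ordered_basis U X" "ordered_basis U Y" "f ` U \<subseteq> U"
  shows "set (map f Y) \<subseteq> span (set X)" "f ` set Y \<subseteq> span (set X)"
proof -
  show "f ` set Y \<subseteq> span (set X)"
    unfolding ordered_basisD(3)[OF assms(1)] using ordered_basisD(4)[OF assms(2)] assms(3) by fast
  then show "set (map f Y) \<subseteq> span (set X)" by simp
qed

section \<open>Determinants of endomorphisms\<close>

lemma coord_mat_inverse: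
  assumes X: "ordered_basis U X" and Y: "ordered_basis U Y"
  shows "coord_mat X Y * coord_mat Y X = 1\<^sub>m (length X)"
proof -
  note X = ordered_basisD[OF X] and Y = ordered_basisD[OF Y]
  have "coord_mat X X = coord_mat X Y * coord_mat Y X"
    by (rule coord_mat_mult) (use X Y in auto)
  then show ?thesis using coord_mat_self[OF X(1,2)] by simp
qed

lemma det_coord_mat_nonzero:
  assumes X: "ordered_basis U X" and Y: "ordered_basis U Y"
  shows "det (coord_mat X Y) \<noteq> 0"
proof -
  have len: "length Y = length X" using ordered_basis_length X Y by metis
  have "det (coord_mat X Y) * det (coord_mat Y X) = det (coord_mat X Y * coord_mat Y X)"
    by (rule det_mult[symmetric, of _ "length X"])
      (use len coord_mat_carrier[of X Y] coord_mat_carrier[of Y X] in auto)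
  then show ?thesis using coord_mat_inverse[OF X Y] by auto
qed

text \<open>This makes the definite descriptions in \<open>lin_det\<close> and
  \<open>lin_char_poly\<close> meaningful: similar matrices share determinant and characteristic
  polynomial.\<close>

lemma similar_matrix_wrt:
  assumes X: "ordered_basis U X" and Y: "ordered_basis U Y"
    and f: "Vector_Spaces.linear scale scale f" "f ` U \<subseteq> U"
  shows "similar_mat (matrix_wrt X f) (matrix_wrt Y f)"
proof -
  define n where "n = length X"
  have len: "length Y = n" "length X = n" using ordered_basis_length X Y n_def by metis+
  have PQ: "coord_mat X Y * coord_mat Y X = 1\<^sub>m n" "coord_mat Y X * coord_mat X Y = 1\<^sub>m n"
    using coord_mat_inverse[OF X Y] coord_mat_inverse[OF Y X] len by auto
  have carrier: "{coord_mat X (map f X), coord_mat Y (map f Y), coord_mat X Y, coord_mat Y X}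
      \<subseteq> carrier_mat n n"
    using len coord_mat_carrier[of X "map f X"] coord_mat_carrier[of Y "map f Y"]
      coord_mat_carrier[of X Y] coord_mat_carrier[of Y X] by (simp del: coord_mat_carrier)
  note X' = ordered_basisD[OF X] and Y' = ordered_basisD[OF Y]
  have "coord_mat X (map f X) = coord_mat X (map f Y) * coord_mat Y X"
    by (rule coord_mat_map) (use X' Y' f ordered_basis_invariant[OF X Y f(2)] in simp_all)
  also have "coord_mat X (map f Y) = coord_mat X Y * coord_mat Y (map f Y)"
    by (rule coord_mat_mult) (use X' Y' f ordered_basis_invariant[OF Y Y f(2)] in simp_all)
  finally show ?thesis
    unfolding matrix_wrt_eq_coord_mat by (rule similar_matI[OF carrier PQ])
qed

lemma lin_det_eq:
  assumes X: "ordered_basis U X" and f: "Vector_Spaces.linear scale scale f" "f ` U \<subseteq> U"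
  shows "lin_det U f = det (matrix_wrt X f)"
  unfolding lin_det_def
  by (rule the_equality) (use X det_similar[OF similar_matrix_wrt[OF _ X f]] in blast)+

lemma lin_char_poly_eq:
  assumes X: "ordered_basis U X" and f: "Vector_Spaces.linear scale scale f" "f ` U \<subseteq> U"
  shows "lin_char_poly U f = char_poly (matrix_wrt X f)"
  unfolding lin_char_poly_def
  by (rule the_equality) (use X char_poly_similar[OF similar_matrix_wrt[OF _ X f]] in blast)+

text \<open>Instead of block matrices, a form normalized to 1 on \<open>Y @ Z\<close> is evaluated
  on the image of this basis, and each block releases its own determinant.\<close>

lemma lin_det_direct_sum:
  assumes Y: "ordered_basis U Y" and Z: "ordered_basis W Z" and V: "ordered_basis V (Y @ Z)"
    and f: "Vector_Spaces.linear scale scale f" "f ` U \<subseteq> U" "f ` W \<subseteq> W" "f ` V \<subseteq> V"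
  shows "lin_det V f = lin_det U f * lin_det W f"
proof -
  note Y' = ordered_basisD[OF Y] and Z' = ordered_basisD[OF Z] and V' = ordered_basisD[OF V]
  obtain \<omega> where \<omega>: "alternating_form (length (Y @ Z)) \<omega>" "\<omega> (Y @ Z) = 1"
    using alternating_form_nonzero[OF V'(1,2)] by blast
  have "\<omega> (map f (Y @ Z)) = det (coord_mat (Y @ Z) (map f (Y @ Z))) * \<omega> (Y @ Z)"
    by (rule alternating_form_change_basis[OF \<omega>(1) V'(1,2)]) (use ordered_basis_invariant[OF V V f(4)] in simp_all)
  then have "lin_det V f = \<omega> (map f Y @ map f Z)"
    using lin_det_eq[OF V f(1,4)] \<omega>(2) by (simp add: matrix_wrt_eq_coord_mat)
  also have "\<dots> = det (coord_mat Y (map f Y)) * \<omega> (Y @ map f Z)"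
    by (rule alternating_form_change_left[OF \<omega>(1)]) (use Y' ordered_basis_invariant[OF Y Y f(2)] in simp_all)
  also have "\<omega> (Y @ map f Z) = det (coord_mat Z (map f Z)) * \<omega> (Y @ Z)"
    by (rule alternating_form_change_right[OF \<omega>(1)]) (use Z' ordered_basis_invariant[OF Z Z f(3)] in simp_all)
  finally show ?thesis
    using lin_det_eq[OF Y f(1,2)] lin_det_eq[OF Z f(1,3)] \<omega>(2) by (simp add: matrix_wrt_eq_coord_mat)
qed

text \<open>In the transported basis \<open>map g X\<close> of the image, \<open>f\<close> has the
  same matrix as in \<open>X\<close>, because \<open>g\<close> intertwines.\<close>

lemma lin_det_image:
  assumes X: "ordered_basis U X"
    and f: "Vector_Spaces.linear scale scale f" "f ` U \<subseteq> U"
    and g: "Vector_Spaces.linear scale scale g" "inj_on g U"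
    and comm: "\<And>v. v \<in> U \<Longrightarrow> f (g v) = g (f v)"
  shows "lin_det (g ` U) f = lin_det U f"
proof -
  note gX = ordered_basis_map[OF g X]
  note X' = ordered_basisD[OF X] and gX' = ordered_basisD[OF gX]
  have "f ` g ` U \<subseteq> g ` U" using comm f(2) by auto
  then have "lin_det (g ` U) f = det (coord_mat (map g X) (map f (map g X)))"
    using lin_det_eq[OF gX f(1)] by (simp add: matrix_wrt_eq_coord_mat)
  also have "map f (map g X) = map g (map f X)" using comm X'(4) by auto
  also have "coord_mat (map g X) (map g (map f X)) = coord_mat X (map f X)"
    by (rule coord_mat_map_inj) (use X' gX' g ordered_basis_invariant[OF X X f(2)] in simp_all)
  finally show ?thesis using lin_det_eq[OF X f] by (simp add: matrix_wrt_eq_coord_mat)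
qed

end

section \<open>Determinant and eigenvalues\<close>

text \<open>Compare the constant terms of the characteristic polynomial and of its factorization
  into linear factors; both carry the sign (-1)^n.\<close>

lemma det_eq_prod_proots_char_poly:
  fixes A :: "complex mat"
  assumes A: "A \<in> carrier_mat n n"
  shows "det A = prod_mset (proots (char_poly A))"
proof -
  obtain as where as: "char_poly A = (\<Prod>a\<leftarrow>as. [:- a, 1:])" "length as = n"
    using char_poly_factorized[OF A] by blast
  have prod: "poly (\<Prod>a\<leftarrow>bs. [:- a, 1:]) 0 = (- 1) ^ length bs * prod_list bs" for bs :: "complex list"
    by (induction bs) auto
  have roots: "proots (\<Prod>a\<leftarrow>bs. [:- a, 1:]) = mset bs" for bs :: "complex list"
  proof (induction bs)
    case (Cons b bs)
    have "(\<Prod>a\<leftarrow>bs. [:- a, 1:]) \<noteq> 0" by (auto simp: prod_list_zero_iff)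
    then have "proots ([:- b, 1:] * (\<Prod>a\<leftarrow>bs. [:- a, 1:])) = {#b#} + mset bs"
      by (subst proots_mult) (simp_all add: Cons.IH)
    then show ?case by simp
  qed auto
  have "char_matrix A 0 = A" unfolding char_matrix_def by (rule eq_matI) (use A in auto)
  then have "poly (char_poly A) 0 = det (- A)" using char_poly_matrix[OF A, of 0] by simp
  also have "- A = (- 1) \<cdot>\<^sub>m A" by (rule eq_matI) auto
  also have "det \<dots> = (- 1) ^ n * det A" using A by simp
  finally have "(- 1) ^ n * det A = (- 1) ^ n * prod_list as" using as prod[of as] by simp
  then show ?thesis using as roots[of as] by (simp add: prod_mset_prod_list)
qed

lemma prod_eigenvalues_eq_det:
  fixes A :: "complex mat" and lam :: "nat \<Rightarrow> complex"
  assumes A: "A \<in> carrier_mat m m"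
    and lam: "\<And>\<mu>. card {j \<in> {1..n}. lam j = \<mu>} = Polynomial.order \<mu> (char_poly A)"
  shows "(\<Prod>j = 1..n. lam j) = det A"
proof -
  have "char_poly A \<noteq> 0" using degree_monic_char_poly[OF A] by auto
  \<comment> \<open>The hypothesis for all values \<open>\<mu>\<close> says that the enumerated
    eigenvalues and the roots form the same multiset; this also forces the right
    \<open>n\<close>.\<close>
  then have "image_mset lam (mset_set {1..n}) = proots (char_poly A)"
    by (intro multiset_eqI) (simp add: count_image_mset_eq_card_vimage flip: lam)
  then show ?thesis
    using det_eq_prod_proots_char_poly[OF A] by (simp add: prod_unfold_prod_mset)
qed

section \<open>Telescoping products\<close>

text \<open>Each inner \<open>E k\<close> occurs in two neighbouring factors with opposite
  exponents. The end term is kept for the induction; it is 1 in the application.\<close>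

lemma prod_mult_shift_powi:
  fixes E :: "nat \<Rightarrow> 'a::field"
  assumes "\<And>k. E k \<noteq> 0" "E 0 = 1"
  shows "(\<Prod>q = 0..N. (E q * E (Suc q)) powi ((- 1) ^ (q + 1))) = E (Suc N) powi ((- 1) ^ (N + 1))"
proof (induction N)
  case (Suc N)
  have "E (Suc N) powi ((- 1) ^ (N + 1)) * E (Suc N) powi (- ((- 1) ^ (N + 1))) = 1"
    using assms(1) by (simp flip: power_int_add)
  then show ?case using Suc.IH by (simp add: power_int_mult_distrib)
qed (use assms in \<open>simp add: power_int_minus\<close>)

text \<open>Summation by parts in multiplicative form: the exponents of \<open>F k\<close> in two
  neighbouring factors have opposite signs and weights that differ by one. The last factor on the
  right is again the boundary term that carries the induction.\<close>

lemma prod_mult_shift_powi_weighted: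
  fixes F :: "nat \<Rightarrow> 'a::field"
  assumes "\<And>k. F k \<noteq> 0" "F 0 = 1"
  shows "inverse (\<Prod>q = 0..N. (F (Suc q) * F q) powi ((- 1) ^ q * int q)) =
    (\<Prod>q = 0..N. F q powi ((- 1) ^ (q + 1))) * F (Suc N) powi ((- 1) ^ Suc N * int N)"
proof (induction N)
  case (Suc N)
  let ?s = "(- 1) ^ Suc N :: int"
  have "F (Suc N) powi (?s * int N) * inverse (F (Suc N) powi (?s * int (Suc N)))
      = F (Suc N) powi (?s * int N - ?s * int (Suc N))"
    using assms(1) by (simp add: power_int_diff divide_inverse del: power_Suc)
  also have "?s * int N - ?s * int (Suc N) = (- 1) ^ (Suc N + 1)" by (simp add: algebra_simps)
  finally have shift: "F (Suc N) powi (?s * int N) * inverse (F (Suc N) powi (?s * int (Suc N)))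
      = F (Suc N) powi ((- 1) ^ (Suc N + 1))" .
  have "inverse (F (Suc (Suc N)) powi (?s * int (Suc N)))
      = F (Suc (Suc N)) powi ((- 1) ^ Suc (Suc N) * int (Suc N))"
    by (simp flip: power_int_minus)
  then show ?case
    using Suc.IH shift by (simp add: power_int_mult_distrib mult_ac del: power_Suc of_nat_Suc)
qed (use assms in simp)

text \<open>A sign is its own inverse, so the alternating exponents of the torsion do not affect the
  signs of its factors.\<close>

lemma power_minus_one_powi_sign: "((- 1) ^ a :: 'a::field) powi ((- 1) ^ k) = (- 1) ^ a"
  by (cases "even k"; cases "even a") (auto simp: power_int_minus)

section \<open>Graded complexes with invertible Laplacian\<close>

locale nonsingular_laplacian = graded_complex +
  assumes not_eigenvalue_0: "\<not> is_eigenvalue laplacian 0"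
begin

interpretation d: Vector_Spaces.linear scale scale d by (rule linear_d)
interpretation ds: Vector_Spaces.linear scale scale ds by (rule linear_ds)

section \<open>Commutation and invertibility of the Laplacian\<close>

lemma linear_laplacian: "Vector_Spaces.linear scale scale laplacian"
  by unfold_locales
    (auto simp: laplacian_def d.add ds.add d.scale ds.scale scale_right_distrib)

interpretation lap: Vector_Spaces.linear scale scale laplacian by (rule linear_laplacian)

lemma d_laplacian: "d (laplacian v) = laplacian (d v)"
  by (simp add: laplacian_def d.add ds.add d_d ds_ds d.zero ds.zero)

lemma ds_laplacian: "ds (laplacian v) = laplacian (ds v)"
  by (simp add: laplacian_def d.add ds.add d_d ds_ds d.zero ds.zero)

lemma laplacian_eq_0: "laplacian v = 0 \<Longrightarrow> v = 0"
  using not_eigenvalue_0 by (auto simp: is_eigenvalue_def)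

lemma inj_laplacian: "inj laplacian"
  using lap.inj_iff_eq_0 laplacian_eq_0 by blast

lemma subspace_basis_exists: "subspace U \<Longrightarrow> \<exists>X. ordered_basis U X"
  using finite_dimensional ordered_basis_exists by (metis subset_UNIV)

text \<open>Injectivity preserves the dimension. The gain is a preimage that stays in
  \<open>U\<close>, which does the work of an inverse operator commuting with the
  differentials.\<close>

lemma laplacian_image_eq:
  assumes U: "subspace U" "laplacian ` U \<subseteq> U"
  shows "laplacian ` U = U"
proof -
  obtain B where B: "ordered_basis UNIV B" using subspace_basis_exists[of UNIV] by auto
  interpret fd: finite_dimensional_vector_space scale "set B"
    by unfold_locales (use ordered_basisD[OF B] in auto)
  obtain X where X: "ordered_basis U X" using subspace_basis_exists[OF U(1)] by blast
  have "ordered_basis (laplacian ` U) (map laplacian X)"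
    by (rule ordered_basis_map[OF linear_laplacian _ X]) (use inj_laplacian inj_on_subset in blast)
  then have "dim (laplacian ` U) = dim U" using ordered_basis_length X by (metis length_map)
  then show ?thesis
    using fd.subspace_dim_equal[OF lap.subspace_image[OF U(1)] U] by simp
qed

lemma d_C: "v \<in> C q \<Longrightarrow> d v \<in> C (q + 1)" and ds_C: "v \<in> C q \<Longrightarrow> ds v \<in> C (q - 1)"
  using d_degree ds_degree by blast+

lemma laplacian_C: "laplacian ` C q \<subseteq> C q"
proof
  fix w assume "w \<in> laplacian ` C q"
  then obtain v where v: "v \<in> C q" "w = laplacian v" by blast
  have "d (ds v) \<in> C q" "ds (d v) \<in> C q"
    using d_C[OF ds_C[OF v(1)]] ds_C[OF d_C[OF v(1)]] by auto
  then show "w \<in> C q" using v(2) subspace_add[OF subspace_C] by (simp add: laplacian_def)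
qed

section \<open>Vanishing of cohomology and homology\<close>

lemma subspace_upper_Z: "subspace (upper_Z q)"
  using subspace_C[of q] unfolding upper_Z_def subspace_def by (auto simp: d.add d.scale d.zero)

lemma subspace_lower_Z: "subspace (lower_Z q)"
  using subspace_C[of q] unfolding lower_Z_def subspace_def by (auto simp: ds.add ds.scale ds.zero)

lemma laplacian_upper_Z: "laplacian ` upper_Z q \<subseteq> upper_Z q"
  using laplacian_C d_laplacian lap.zero unfolding upper_Z_def by auto

lemma laplacian_lower_Z: "laplacian ` lower_Z q \<subseteq> lower_Z q"
  using laplacian_C ds_laplacian lap.zero unfolding lower_Z_def by auto

text \<open>\<open>ds\<close> acts as a contracting homotopy: a cocycle is the Laplacian of another
  cocycle \<open>w\<close>, and on \<open>w\<close> only the term \<open>d (ds w)\<close>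
  survives.\<close>

lemma upper_Z_eq_upper_B: "upper_Z q = upper_B q"
proof
  show "upper_B q \<subseteq> upper_Z q"
    using d_C[of _ "q - 1"] d_d by (auto simp: upper_B_def upper_Z_def)
  show "upper_Z q \<subseteq> upper_B q"
  proof
    fix v assume "v \<in> upper_Z q"
    then obtain w where w: "w \<in> upper_Z q" "v = laplacian w"
      using laplacian_image_eq[OF subspace_upper_Z laplacian_upper_Z] by blast
    then have "v = d (ds w)" by (simp add: laplacian_def upper_Z_def ds.zero)
    then show "v \<in> upper_B q" using ds_C w(1) by (auto simp: upper_B_def upper_Z_def)
  qed
qed

lemma lower_Z_eq_lower_B: "lower_Z q = lower_B q"
proof
  show "lower_B q \<subseteq> lower_Z q"
    using ds_C[of _ "q + 1"] ds_ds by (auto simp: lower_B_def lower_Z_def)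
  show "lower_Z q \<subseteq> lower_B q"
  proof
    fix v assume "v \<in> lower_Z q"
    then obtain w where w: "w \<in> lower_Z q" "v = laplacian w"
      using laplacian_image_eq[OF subspace_lower_Z laplacian_lower_Z] by blast
    then have "v = ds (d w)" by (simp add: laplacian_def lower_Z_def d.zero)
    then show "v \<in> lower_B q" using d_C w(1) by (auto simp: lower_B_def lower_Z_def)
  qed
qed

text \<open>Vanishing as a set of classes: the zero class, which is \<open>upper_B q\<close> itself,
  is the only one.\<close>

lemma cohomology_eq: "cohomology q = {upper_B q}"
proof -
  have "x - y \<in> upper_B q" if "x \<in> upper_Z q" "y \<in> upper_Z q" for x y
    using that subspace_diff[OF subspace_upper_Z] upper_Z_eq_upper_B by simp
  moreover have "0 \<in> upper_Z q" using subspace_0[OF subspace_upper_Z] .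
  ultimately show ?thesis
    unfolding cohomology_def quotient_def upper_Z_eq_upper_B by auto
qed

lemma homology_eq: "homology q = {lower_B q}"
proof -
  have "x - y \<in> lower_B q" if "x \<in> lower_Z q" "y \<in> lower_Z q" for x y
    using that subspace_diff[OF subspace_lower_Z] lower_Z_eq_lower_B by simp
  moreover have "0 \<in> lower_Z q" using subspace_0[OF subspace_lower_Z] .
  ultimately show ?thesis
    unfolding homology_def quotient_def lower_Z_eq_lower_B by auto
qed

section \<open>The splitting of each degree\<close>

lemma in_upper_B_iff: "v \<in> upper_B q \<longleftrightarrow> v \<in> C q \<and> d v = 0"
  using upper_Z_eq_upper_B[of q] by (auto simp: upper_Z_def)

lemma in_lower_B_iff: "v \<in> lower_B q \<longleftrightarrow> v \<in> C q \<and> ds v = 0"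
  using lower_Z_eq_lower_B[of q] by (auto simp: lower_Z_def)

lemma subspace_upper_B: "subspace (upper_B q)" and subspace_lower_B: "subspace (lower_B q)"
  using subspace_upper_Z subspace_lower_Z upper_Z_eq_upper_B lower_Z_eq_lower_B by auto

lemma laplacian_upper_B: "laplacian ` upper_B q \<subseteq> upper_B q"
  and laplacian_lower_B: "laplacian ` lower_B q \<subseteq> lower_B q"
  using laplacian_upper_Z laplacian_lower_Z upper_Z_eq_upper_B lower_Z_eq_lower_B by auto

lemma upper_B_Int_lower_B: "upper_B q \<inter> lower_B q = {0}"
proof -
  have "v = 0" if "v \<in> upper_B q" "v \<in> lower_B q" for v
    using that laplacian_eq_0[of v] by (simp add: in_upper_B_iff in_lower_B_iff laplacian_def d.zero ds.zero)
  then show ?thesis using subspace_0[OF subspace_upper_B] subspace_0[OF subspace_lower_B] by auto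
qed

text \<open>Once \<open>v\<close> is written as a Laplacian, its two terms are the
  components.\<close>

lemma C_eq_upper_B_plus_lower_B: "C q = {u + w |u w. u \<in> upper_B q \<and> w \<in> lower_B q}"
proof
  show "C q \<subseteq> {u + w |u w. u \<in> upper_B q \<and> w \<in> lower_B q}"
  proof
    fix v assume "v \<in> C q"
    then obtain x where x: "x \<in> C q" "v = laplacian x"
      using laplacian_image_eq[OF subspace_C laplacian_C] by blast
    have "d (ds x) \<in> upper_B q" "ds (d x) \<in> lower_B q"
      using x(1) d_C ds_C by (auto simp: upper_B_def lower_B_def)
    then show "v \<in> {u + w |u w. u \<in> upper_B q \<and> w \<in> lower_B q}"
      using x(2) unfolding laplacian_def by blast
  qed
  show "{u + w |u w. u \<in> upper_B q \<and> w \<in> lower_B q} \<subseteq> C q"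
    using subspace_add[OF subspace_C] by (auto simp: in_upper_B_iff in_lower_B_iff)
qed

lemma inj_on_d: "inj_on d (lower_B q)"
proof (rule inj_onI)
  fix x y assume xy: "x \<in> lower_B q" "y \<in> lower_B q" "d x = d y"
  then have "x - y \<in> lower_B q" by (simp add: subspace_diff[OF subspace_lower_B])
  moreover from this have "x - y \<in> upper_B q"
    using xy by (simp add: in_upper_B_iff in_lower_B_iff d.diff)
  ultimately have "x - y = 0" using upper_B_Int_lower_B[of q] by blast
  then show "x = y" by simp
qed

lemma inj_on_ds: "inj_on ds (upper_B q)"
proof (rule inj_onI)
  fix x y assume xy: "x \<in> upper_B q" "y \<in> upper_B q" "ds x = ds y"
  then have "x - y \<in> upper_B q" by (simp add: subspace_diff[OF subspace_upper_B])
  moreover from this have "x - y \<in> lower_B q"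
    using xy by (simp add: in_upper_B_iff in_lower_B_iff ds.diff)
  ultimately have "x - y = 0" using upper_B_Int_lower_B[of q] by blast
  then show "x = y" by simp
qed

lemma d_image_lower_B: "d ` lower_B q = upper_B (q + 1)"
proof -
  have "d ` C q = d ` lower_B q"
    unfolding C_eq_upper_B_plus_lower_B[of q]
    using subspace_0[OF subspace_upper_B[of q]]
    by (force simp: d.add in_upper_B_iff)
  then show ?thesis by (simp add: upper_B_def)
qed

lemma ds_image_upper_B: "ds ` upper_B (q + 1) = lower_B q"
proof -
  have "ds ` C (q + 1) = ds ` upper_B (q + 1)"
    unfolding C_eq_upper_B_plus_lower_B[of "q + 1"]
    using subspace_0[OF subspace_lower_B[of "q + 1"]]
    by (force simp: ds.add in_lower_B_iff)
  then show ?thesis by (simp add: lower_B_def)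
qed

section \<open>Determinants of the Laplacian on the summands\<close>

definition det_upper :: "int \<Rightarrow> complex" where
  "det_upper q = lin_det (upper_B (q + 1)) laplacian"

lemma lin_det_lower_B: "lin_det (lower_B q) laplacian = det_upper q"
proof -
  obtain X where "ordered_basis (lower_B q) X"
    using subspace_basis_exists[OF subspace_lower_B] by blast
  from lin_det_image[OF this linear_laplacian laplacian_lower_B linear_d inj_on_d]
  show ?thesis by (simp add: d_image_lower_B det_upper_def d_laplacian)
qed

lemma lin_det_C: "lin_det (C q) laplacian = det_upper q * det_upper (q - 1)"
proof -
  obtain Y Z where YZ: "ordered_basis (upper_B q) Y" "ordered_basis (lower_B q) Z"
    using subspace_basis_exists subspace_upper_B subspace_lower_B by metis
  have "ordered_basis (C q) (Y @ Z)"
    using ordered_basis_append[OF YZ upper_B_Int_lower_B] C_eq_upper_B_plus_lower_B by simp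
  from lin_det_direct_sum[OF YZ this linear_laplacian laplacian_upper_B laplacian_lower_B laplacian_C]
  show ?thesis using lin_det_lower_B by (simp add: det_upper_def mult.commute)
qed

lemma det_upper_nonzero: "det_upper q \<noteq> 0"
proof -
  obtain X where X: "ordered_basis (upper_B (q + 1)) X"
    using subspace_basis_exists[OF subspace_upper_B] by blast
  have "inj_on laplacian (upper_B (q + 1))" using inj_laplacian inj_on_subset by blast
  from ordered_basis_map[OF linear_laplacian this X]
  have "ordered_basis (upper_B (q + 1)) (map laplacian X)"
    using laplacian_image_eq[OF subspace_upper_B laplacian_upper_B] by simp
  then show ?thesis
    using det_coord_mat_nonzero[OF X] lin_det_eq[OF X linear_laplacian laplacian_upper_B]
    by (simp add: det_upper_def matrix_wrt_eq_coord_mat)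
qed

text \<open>\<open>Y @ bd q\<close> is the common reference basis of \<open>C q\<close>: under an
  arbitrary form both lists are reduced to it. The two \<open>coord_mat\<close> determinants have
  the same shape in consecutive degrees, as the cancellation over q requires.\<close>

lemma wedge_ratio_eq:
  assumes "torsion_choice bu lu bd ld"
  shows "wedge_ratio (bu q @ lu (q + 1)) (bd q @ ld (q - 1)) =
    det (coord_mat (map d (bd (q - 1))) (bu q)) * det (coord_mat (map d (bd q)) (bu (q + 1))) *
    (- 1) ^ (length (bd (q - 1)) * length (bd q)) * det_upper (q - 1)"
proof -
  have bu: "ordered_basis (upper_B k) (bu k)" and bd: "ordered_basis (lower_B k) (bd k)"
    and lu: "set (lu k) \<subseteq> C (k - 1)" "map d (lu k) = bu k"
    and ld: "set (ld k) \<subseteq> C (k + 1)" "map ds (ld k) = bd k" for k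
    using assms unfolding torsion_choice_def by auto
  have dbd: "ordered_basis (upper_B (k + 1)) (map d (bd k))" for k
    using ordered_basis_map[OF linear_d inj_on_d bd[of k]] by (simp add: d_image_lower_B)
  have len: "length (bu (k + 1)) = length (bd k)" for k
    using ordered_basis_length[OF dbd[of k]] ordered_basis_length[OF bu[of "k + 1"]] by simp
  note len' = len[of "q - 1", simplified]
  have len_l: "length (lu k) = length (bu k)" "length (ld k) = length (bd k)" for k
    using lu(2)[of k] ld(2)[of k] by (metis length_map)+
  have "ordered_basis (d ` lower_B q) (bu (q + 1))" using bu d_image_lower_B by simp
  then obtain P where P: "ordered_basis (lower_B q) P" "map d P = bu (q + 1)"
    using ordered_basis_lift[OF linear_d inj_on_d subspace_lower_B] by metis
  have "ordered_basis (ds ` upper_B q) (bd (q - 1))"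
    using bd[of "q - 1"] ds_image_upper_B[of "q - 1"] by simp
  then obtain Y where Y_basis: "ordered_basis (upper_B q) Y" and Y: "map ds Y = bd (q - 1)"
    using ordered_basis_lift[OF linear_ds inj_on_ds subspace_upper_B] by metis
  have length_Y: "length Y = length (bd (q - 1))" using Y by (metis length_map)
  have length_P: "length P = length (bd q)" using P(2) len by (metis length_map)
  have P_sub: "set P \<subseteq> lower_B q" and Y_sub: "set Y \<subseteq> upper_B q"
    using ordered_basisD(4) P(1) Y_basis by blast+
  note bu' = ordered_basisD[OF bu] and bd' = ordered_basisD[OF bd] and dbd' = ordered_basisD[OF dbd]
    and Y' = ordered_basisD[OF Y_basis]
  \<comment> \<open>Two lifts in \<open>C q\<close> of the same vector differ by a cocycle, hence by
    an element of \<open>upper_B q\<close>, the span of the block \<open>bu q\<close> in front of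
    them.\<close>
  have shift_lu: "list_all2 (\<lambda>y y'. y - y' \<in> span (set (bu q))) (lu (q + 1)) P"
  proof (rule list_all2_all_nthI)
    show "length (lu (q + 1)) = length P" by (simp add: length_P len_l len)
    fix i assume i: "i < length (lu (q + 1))"
    then have i': "i < length P" by (simp add: length_P len_l len)
    have "lu (q + 1) ! i \<in> C q" "P ! i \<in> C q"
      using lu(1)[of "q + 1"] P_sub nth_mem[OF i] nth_mem[OF i'] by (auto simp: in_lower_B_iff)
    moreover have "d (lu (q + 1) ! i) = d (P ! i)"
      using lu(2)[of "q + 1"] P(2) i i' by (metis nth_map)
    ultimately show "lu (q + 1) ! i - P ! i \<in> span (set (bu q))"
      by (simp add: bu'(3) in_upper_B_iff d.diff subspace_diff[OF subspace_C])
  qed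
  have shift_ld: "list_all2 (\<lambda>y y'. y - y' \<in> span (set (bd q))) (ld (q - 1)) Y"
  proof (rule list_all2_all_nthI)
    show "length (ld (q - 1)) = length Y" by (simp add: length_Y len_l)
    fix i assume i: "i < length (ld (q - 1))"
    then have i': "i < length Y" by (simp add: length_Y len_l)
    have "ld (q - 1) ! i \<in> C q" "Y ! i \<in> C q"
      using ld(1)[of "q - 1"] Y_sub nth_mem[OF i] nth_mem[OF i'] by (auto simp: in_upper_B_iff)
    moreover have "ds (ld (q - 1) ! i) = ds (Y ! i)"
      using ld(2)[of "q - 1"] Y i i' by (metis nth_map)
    ultimately show "ld (q - 1) ! i - Y ! i \<in> span (set (bd q))"
      by (simp add: bd'(3) in_lower_B_iff ds.diff subspace_diff[OF subspace_C])
  qed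
  define n where "n = length (bd q @ ld (q - 1))"
  have n: "n = length (bd q) + length (bd (q - 1))" by (simp add: n_def len_l)
  have lower: "\<omega> (bd q @ ld (q - 1)) = (- 1) ^ (length (bd (q - 1)) * length (bd q)) * \<omega> (Y @ bd q)"
    if \<omega>: "alternating_form n \<omega>" for \<omega>
  proof -
    have "\<omega> (bd q @ ld (q - 1)) = \<omega> (bd q @ Y)"
      using alternating_form_shift[OF \<omega> shift_ld, of "[]"] n len_l by simp
    also have "\<dots> = (- 1) ^ (length (bd (q - 1)) * length (bd q)) * \<omega> (Y @ bd q)"
      using alternating_form_swap[OF \<omega>, of "bd q" Y] n length_Y by (simp add: mult.commute)
    finally show ?thesis .
  qed
  have upper: "\<omega> (bu q @ lu (q + 1)) = det (coord_mat (map d (bd (q - 1))) (bu q)) *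
      det (coord_mat (map d (bd q)) (bu (q + 1))) * det_upper (q - 1) * \<omega> (Y @ bd q)"
    if \<omega>: "alternating_form n \<omega>" for \<omega>
  proof -
    have "\<omega> (bu q @ lu (q + 1)) = \<omega> (bu q @ P)"
      using alternating_form_shift[OF \<omega> shift_lu, of "[]"] n len len' len_l by simp
    also have "\<dots> = det (coord_mat (map d (bd (q - 1))) (bu q)) * \<omega> (map d (bd (q - 1)) @ P)"
      by (rule alternating_form_change_left[OF \<omega>])
        (use n length_P len' dbd'[of "q - 1"] bu'[of q] in auto)
    also have "\<omega> (map d (bd (q - 1)) @ P) = det (coord_mat (bd q) P) * \<omega> (map d (bd (q - 1)) @ bd q)"
      by (rule alternating_form_change_right[OF \<omega>]) (use n length_P bd' P_sub in auto)
    \<comment> \<open>Applying \<open>d\<close> moves the comparison from \<open>lower_B q\<close>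
      to \<open>upper_B (q + 1)\<close>, where it takes the form of the first determinant in the
      next degree.\<close>
    also have "coord_mat (bd q) P = coord_mat (map d (bd q)) (bu (q + 1))"
      unfolding P(2)[symmetric]
      by (rule coord_mat_map_inj[symmetric]) (use dbd' bd' P_sub linear_d in auto)
    also have "\<omega> (map d (bd (q - 1)) @ bd q) = \<omega> (map laplacian Y @ bd q)"
    proof -
      have "laplacian y = d (ds y)" if "y \<in> set Y" for y
        using that Y_sub by (auto simp: laplacian_def in_upper_B_iff ds.zero)
      then have "map laplacian Y = map d (bd (q - 1))" by (simp flip: Y)
      then show ?thesis by simp
    qed
    also have "\<omega> (map laplacian Y @ bd q) = det (coord_mat Y (map laplacian Y)) * \<omega> (Y @ bd q)"
      by (rule alternating_form_change_left[OF \<omega>])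
        (use n length_Y Y' ordered_basis_invariant[OF Y_basis Y_basis laplacian_upper_B] in simp_all)
    also have "det (coord_mat Y (map laplacian Y)) = det_upper (q - 1)"
      using lin_det_eq[OF Y_basis linear_laplacian laplacian_upper_B]
      by (simp add: det_upper_def matrix_wrt_eq_coord_mat)
    finally show ?thesis by (simp only: mult_ac)
  qed
  have "ordered_basis (C q) (Y @ bd q)"
    using ordered_basis_append[OF Y_basis bd upper_B_Int_lower_B] C_eq_upper_B_plus_lower_B by simp
  from alternating_form_nonzero[OF ordered_basisD(1,2)[OF this]]
  obtain \<omega> where \<omega>: "alternating_form n \<omega>" "\<omega> (Y @ bd q) = 1"
    using n length_Y by (metis add.commute length_append)
  show ?thesis
  proof (rule wedge_ratio_eqI)
    show "length (bu q @ lu (q + 1)) = length (bd q @ ld (q - 1))"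
      using len len' len_l by simp
    show "alternating_form (length (bd q @ ld (q - 1))) \<omega>" "\<omega> (bd q @ ld (q - 1)) \<noteq> 0"
      using \<omega> lower[OF \<omega>(1)] by (auto simp: n_def)
  next
    fix \<eta> assume "alternating_form (length (bd q @ ld (q - 1))) \<eta>"
    then have \<eta>: "alternating_form n \<eta>" by (simp only: n_def)
    \<comment> \<open>The relation \<open>lower\<close> is solved for the reference value; the sign
      squares to 1.\<close>
    have "\<eta> (Y @ bd q) = (- 1) ^ (length (bd (q - 1)) * length (bd q)) * \<eta> (bd q @ ld (q - 1))"
      unfolding lower[OF \<eta>] by (simp flip: power_mult_distrib mult.assoc)
    then show "\<eta> (bu q @ lu (q + 1)) =
      det (coord_mat (map d (bd (q - 1))) (bu q)) * det (coord_mat (map d (bd q)) (bu (q + 1))) *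
      (- 1) ^ (length (bd (q - 1)) * length (bd q)) * det_upper (q - 1) * \<eta> (bd q @ ld (q - 1))"
      unfolding upper[OF \<eta>] by (simp only: mult_ac)
  qed
qed

section \<open>Existence of choices and the boundary degrees\<close>

lemma torsion_choice_exists: "\<exists>bu lu bd ld. torsion_choice bu lu bd ld"
proof -
  obtain bu where bu: "\<And>q. ordered_basis (upper_B q) (bu q)"
    using subspace_basis_exists[OF subspace_upper_B] by metis
  obtain bd where bd: "\<And>q. ordered_basis (lower_B q) (bd q)"
    using subspace_basis_exists[OF subspace_lower_B] by metis
  define lu where "lu q = map (inv_into (C (q - 1)) d) (bu q)" for q
  define ld where "ld q = map (inv_into (C (q + 1)) ds) (bd q)" for q
  have "set (lu q) \<subseteq> C (q - 1) \<and> map d (lu q) = bu q" for q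
    using ordered_basisD(4)[OF bu[of q]] unfolding lu_def upper_B_def
    by (auto intro!: inv_into_into map_idI simp: f_inv_into_f)
  moreover have "set (ld q) \<subseteq> C (q + 1) \<and> map ds (ld q) = bd q" for q
    using ordered_basisD(4)[OF bd[of q]] unfolding ld_def lower_B_def
    by (auto intro!: inv_into_into map_idI simp: f_inv_into_f)
  ultimately show ?thesis using bu bd unfolding torsion_choice_def by blast
qed

text \<open>For \<open>q = 0\<close> it is the source \<open>C (- 1)\<close> of \<open>d\<close>
  that vanishes; above \<open>N\<close> it is the target.\<close>

lemma upper_B_eq_0:
  assumes "q \<le> 0 \<or> q > int N"
  shows "upper_B q = {0}"
proof -
  have "C (q - 1) = {0} \<or> C q = {0}" using assms C_outside[of q] C_outside[of "q - 1"] by auto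
  moreover have "upper_B q \<subseteq> C q" using in_upper_B_iff by blast
  moreover have "upper_B q = d ` C (q - 1)" by (rule upper_B_def)
  ultimately have "upper_B q \<subseteq> {0}" using d.zero by (metis image_empty image_insert order_refl)
  then show ?thesis using subspace_0[OF subspace_upper_B[of q]] by blast
qed

lemma lower_B_eq_0:
  assumes "q < 0 \<or> q \<ge> int N"
  shows "lower_B q = {0}"
proof -
  have "C (q + 1) = {0} \<or> C q = {0}" using assms C_outside[of q] C_outside[of "q + 1"] by auto
  moreover have "lower_B q \<subseteq> C q" using in_lower_B_iff by blast
  moreover have "lower_B q = ds ` C (q + 1)" by (rule lower_B_def)
  ultimately have "lower_B q \<subseteq> {0}" using ds.zero by (metis image_empty image_insert order_refl)
  then show ?thesis using subspace_0[OF subspace_lower_B[of q]] by blast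
qed

lemma det_upper_boundary:
  assumes "q < 0 \<or> q \<ge> int N"
  shows "det_upper q = 1"
proof -
  have B: "upper_B (q + 1) = {0}" by (rule upper_B_eq_0) (use assms in auto)
  obtain X where X: "ordered_basis (upper_B (q + 1)) X"
    using subspace_basis_exists[OF subspace_upper_B] by blast
  then have "X = []" using ordered_basis_zero B by simp
  then show ?thesis
    using lin_det_eq[OF X linear_laplacian laplacian_upper_B]
    by (simp add: det_upper_def matrix_wrt_def)
qed

section \<open>Assembly of the torsion\<close>

lemma torsion_value_eq:
  assumes choice: "torsion_choice bu lu bd ld"
  shows "torsion_value bu lu bd ld =
    inverse (\<Prod>q = 0..N. lin_det (C (int q)) laplacian powi ((- 1) ^ q * int q))"
proof -
  have bu: "ordered_basis (upper_B k) (bu k)" and bd: "ordered_basis (lower_B k) (bd k)" for k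
    using choice unfolding torsion_choice_def by auto
  have dbd: "ordered_basis (upper_B (k + 1)) (map d (bd k))" for k
    using ordered_basis_map[OF linear_d inj_on_d bd[of k]] by (simp add: d_image_lower_B)
  \<comment> \<open>The shift by one makes the families start at degree -1 while being indexed by
    naturals, as the telescoping lemmas expect; both ends 0 and \<open>Suc N\<close> belong to zero
    spaces.\<close>
  define E where "E k = det (coord_mat (map d (bd (int k - 1))) (bu (int k)))" for k
  define F where "F k = det_upper (int k - 1)" for k
  define r where "r k = length (bd (int k - 1))" for k
  have E_nonzero: "E k \<noteq> 0" for k
    unfolding E_def using det_coord_mat_nonzero[OF dbd[of "int k - 1"]] bu by simp
  have E_boundary: "E k = 1" if "k = 0 \<or> k = Suc N" for k
  proof -
    have "bd (int k - 1) = []"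
      by (rule ordered_basis_zero, subst lower_B_eq_0[symmetric, of "int k - 1"]) (use that bd in auto)
    moreover have "bu (int k) = []"
      by (rule ordered_basis_zero, subst upper_B_eq_0[symmetric, of "int k"]) (use that bu in auto)
    ultimately show ?thesis by (simp add: E_def coord_mat_def)
  qed
  have F_nonzero: "F k \<noteq> 0" for k by (simp add: F_def det_upper_nonzero)
  have F_boundary: "F 0 = 1" "F (Suc N) = 1" by (auto simp: F_def det_upper_boundary)
  have ratio: "wedge_ratio (bu (int q) @ lu (int q + 1)) (bd (int q) @ ld (int q - 1)) =
      (E q * E (Suc q)) * (- 1) ^ (r q * r (Suc q)) * F q" for q
    using wedge_ratio_eq[OF choice, of "int q"] by (simp add: E_def F_def r_def add.commute)
  \<comment> \<open>The basis \<open>map d (bd q)\<close> of \<open>upper_B (q + 1)\<close>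
    identifies the products in S with those from the block exchange.\<close>
  have "dim (upper_B (int q + 1)) = r (Suc q)" "dim (lower_B (int q - 1)) = r q" for q
    using ordered_basis_length[OF dbd[of "int q"]] ordered_basis_length[OF bd[of "int q - 1"]]
    by (simp_all add: r_def)
  then have S: "torsion_sign_exponent = (\<Sum>q = 0..N. r q * r (Suc q))"
    by (simp add: torsion_sign_exponent_def)
  have "torsion_value bu lu bd ld = (- 1) ^ torsion_sign_exponent *
      ((\<Prod>q = 0..N. (E q * E (Suc q)) powi ((- 1) ^ (q + 1))) *
       (\<Prod>q = 0..N. (- 1) ^ (r q * r (Suc q))) *
       (\<Prod>q = 0..N. F q powi ((- 1) ^ (q + 1))))"
    unfolding torsion_value_def ratio
    by (simp only: power_int_mult_distrib prod.distrib power_minus_one_powi_sign)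
  \<comment> \<open>The exchange signs multiply to the prefactor of the definition, so that together
    they square to 1.\<close>
  also have "(\<Prod>q = 0..N. (- 1) ^ (r q * r (Suc q))) = (- 1 :: complex) ^ torsion_sign_exponent"
    unfolding S by (simp add: power_sum)
  also have "(\<Prod>q = 0..N. (E q * E (Suc q)) powi ((- 1) ^ (q + 1))) = 1"
    using prod_mult_shift_powi[of E N] E_nonzero E_boundary by simp
  finally have "torsion_value bu lu bd ld = (\<Prod>q = 0..N. F q powi ((- 1) ^ (q + 1)))"
    by (simp flip: power_add mult_2)
  also have "\<dots> = inverse (\<Prod>q = 0..N. (F (Suc q) * F q) powi ((- 1) ^ q * int q))"
    using prod_mult_shift_powi_weighted[of F N] F_nonzero F_boundary by simp
  also have "\<dots> = inverse (\<Prod>q = 0..N. lin_det (C (int q)) laplacian powi ((- 1) ^ q * int q))"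
    by (simp add: F_def lin_det_C)
  finally show ?thesis .
qed

text \<open>The right-hand side of \<open>torsion_value_eq\<close> does not mention the choice; this
  is the independence that the definite description asks for.\<close>

lemma torsion_eq:
  "torsion = inverse (\<Prod>q = 0..N. lin_det (C (int q)) laplacian powi ((- 1) ^ q * int q))"
proof -
  obtain bu lu bd ld where "torsion_choice bu lu bd ld" using torsion_choice_exists by blast
  then show ?thesis
    unfolding torsion_def
    by (intro the_equality) (blast intro: torsion_value_eq[symmetric], use torsion_value_eq in blast)
qed

lemma lin_det_C_eq_prod_eigenvalues:
  fixes n :: nat and lam :: "nat \<Rightarrow> complex"
  assumes "\<And>\<mu>. card {j \<in> {1..n}. lam j = \<mu>} = algebraic_multiplicity (C q) laplacian \<mu>"
  shows "lin_det (C q) laplacian = (\<Prod>j = 1..n. lam j)"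
proof -
  obtain X where X: "ordered_basis (C q) X" using subspace_basis_exists[OF subspace_C] by blast
  have "matrix_wrt X laplacian \<in> carrier_mat (length X) (length X)" by (simp add: matrix_wrt_def)
  then have "det (matrix_wrt X laplacian) = (\<Prod>j = 1..n. lam j)"
  proof (rule prod_eigenvalues_eq_det[symmetric])
    show "card {j \<in> {1..n}. lam j = \<mu>} = Polynomial.order \<mu> (char_poly (matrix_wrt X laplacian))" for \<mu>
      using assms[of \<mu>]
      by (simp only: algebraic_multiplicity_def lin_char_poly_eq[OF X linear_laplacian laplacian_C])
  qed
  then show ?thesis by (simp only: lin_det_eq[OF X linear_laplacian laplacian_C])
qed

end

theorem claimB:
  fixes scale :: "complex \<Rightarrow> 'v::ab_group_add \<Rightarrow> 'v"
    and N :: nat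
    and C :: "int \<Rightarrow> 'v set"
    and d ds :: "'v \<Rightarrow> 'v"
    and n :: "nat \<Rightarrow> nat"
    and lam :: "nat \<Rightarrow> nat \<Rightarrow> complex"
  assumes graded_complex: "graded_complex scale N C d ds"
    and no_zero: "\<not> complex_space.is_eigenvalue scale (graded_complex.laplacian d ds) 0"
    and eigenvalues: "\<And>q \<mu>. q \<le> N \<Longrightarrow>
      card {j \<in> {1..n q}. lam q j = \<mu>} =
        complex_space.algebraic_multiplicity scale (C (int q)) (graded_complex.laplacian d ds) \<mu>"
  shows "(\<forall>q. graded_complex.cohomology C d q = {graded_complex.upper_B C d q}) \<and>
    (\<forall>q. graded_complex.homology C ds q = {graded_complex.lower_B C ds q}) \<and>
    graded_complex.torsion scale N C d ds =
      inverse (\<Prod>q = 0..N.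
        complex_space.lin_det scale (C (int q)) (graded_complex.laplacian d ds)
          powi ((- 1) ^ q * int q)) \<and>
    inverse (\<Prod>q = 0..N.
        complex_space.lin_det scale (C (int q)) (graded_complex.laplacian d ds)
          powi ((- 1) ^ q * int q)) =
      inverse (\<Prod>q = 0..N. (\<Prod>j = 1..n q. lam q j) powi ((- 1) ^ q * int q))"
proof -
  interpret nonsingular_laplacian scale N C d ds
    using graded_complex no_zero
    by (simp add: nonsingular_laplacian_def nonsingular_laplacian_axioms_def)
  show ?thesis
    using cohomology_eq homology_eq torsion_eq lin_det_C_eq_prod_eigenvalues[OF eigenvalues] by simp
qed

end
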